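(* Let $U$ be a topological group, $N$ an open normal subgroup of $U$, and $G\subset U$ a topological rough group with respect to $N$. Let $\tau$ be the topology on $\overline{G}$ induced from $U$. If $H$ is a topological rough subgroup of $G$ with respect to $N$, then the following hold, where $H^c_\tau$ denotes the closure of $H$ in $(\overline{G},\tau)$ and $H^c$ denotes the closure of $H$ in $G$: (1) $\overline{H_\tau^c}=\overline{H_\tau^c\cap G}=\overline{H}=HN$. (2) $H_\tau^c$ is a topological rough group with respect to $N$, and $\overline{H_\tau^c}=\overline{H}=HN$. (3) $H^c$ is a topological rough subgroup of $G$ with respect to $N$, and $\overline{H^c}=\overline{H}=HN$.
   Context: An approximation space $(U,R)$ is a non-empty set $U$ with an equivalence relation $R$; for $X\subset U$ the upper approximation is $\overline{X}=\{x\in U:[x]_R\cap X\neq\emptyset\}$, where $[x]_R$ is the equivalence class of $x$ (so $\overline{X}$ never denotes topological closure). Let $U$ carry a binary operation, written $xy$; for subsets, $XY=\{xy:x\in X,y\in Y\}$. A subset $G\subset U$ is a rough group if: (1) $xy\in\overline{G}$ for all $x,y\in G$; (2) $(xy)z=x(yz)$ for all $x,y,z\in\overline{G}$; (3) there is $e\in\overline{G}$ (the rough identity element) with $ex=xe=x$ for all $x\in\overline{G}$; (4) for every $x\in G$ there is $y\in G$ with $xy=yx=e$ (written $y=x^{-1}$). A topological rough group is a rough group $G$ together with a topology $\tau$ on $\overline{G}$ such that, with $\tau_G$ the subspace topology on $G$, the multiplication $G\times G\to\overline{G}$ is continuous (product topology of $\tau_G$ on $G\times G$, $\tau$ on $\overline{G}$)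 and the inverse mapping $G\to G$ is continuous for $\tau_G$. A non-empty subset $H\subset G$ of a rough group $G$ is a rough subgroup if it is itself a rough group (with the same approximation space and operation); a topological rough subgroup is a rough subgroup with the relative topology. Topological rough (sub)group with respect to $N$: $U$ is a topological group, $N$ is a normal subgroup of $U$, the equivalence relation $R$ on $U$ is the one whose classes are the cosets $uN$, $u\in U$, and $G\subset U$ is a non-empty subset that is a topological rough group for the approximation space $(U,R)$, the group operation of $U$, and the topology on $\overline{G}$ inherited from $U$ (similarly for rough subgroups). *)

theory Defs
  imports "HOL-Analysis.Abstract_Topology" "HOL-Analysis.Product_Topology" "HOL-Algebra.Coset"
begin

definition approximation_space :: "'a set \<Rightarrow> ('a \<times> 'a) set \<Rightarrow> bool" where
  "approximation_space U R \<longleftrightarrow> U \<noteq> {} \<and> equiv U R"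

definition upper_approx :: "'a set \<Rightarrow> ('a \<times> 'a) set \<Rightarrow> 'a set \<Rightarrow> 'a set" where
  "upper_approx U R X = {x \<in> U. R `` {x} \<inter> X \<noteq> {}}"

definition is_rough_identity ::
    "'a set \<Rightarrow> ('a \<times> 'a) set \<Rightarrow> ('a \<Rightarrow> 'a \<Rightarrow> 'a) \<Rightarrow> 'a set \<Rightarrow> 'a \<Rightarrow> bool" where
  "is_rough_identity U R m G e \<longleftrightarrow>
     e \<in> upper_approx U R G \<and> (\<forall>x \<in> upper_approx U R G. m e x = x \<and> m x e = x)"

(* The operation m is a HOL function on the whole type; only its values on U \<times> U matter, and
   it is required to be a binary operation on U. *)
definition rough_group ::
    "'a set \<Rightarrow> ('a \<times> 'a) set \<Rightarrow> ('a \<Rightarrow> 'a \<Rightarrow> 'a) \<Rightarrow> 'a set \<Rightarrow> bool" where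
  "rough_group U R m G \<longleftrightarrow>
     approximation_space U R \<and> (\<forall>x\<in>U. \<forall>y\<in>U. m x y \<in> U) \<and> G \<subseteq> U \<and>
     (\<forall>x\<in>G. \<forall>y\<in>G. m x y \<in> upper_approx U R G) \<and>
     (\<forall>x \<in> upper_approx U R G. \<forall>y \<in> upper_approx U R G. \<forall>z \<in> upper_approx U R G.
        m (m x y) z = m x (m y z)) \<and>
     (\<exists>e. is_rough_identity U R m G e \<and> (\<forall>x\<in>G. \<exists>y\<in>G. m x y = e \<and> m y x = e))"

definition rough_identity ::
    "'a set \<Rightarrow> ('a \<times> 'a) set \<Rightarrow> ('a \<Rightarrow> 'a \<Rightarrow> 'a) \<Rightarrow> 'a set \<Rightarrow> 'a" where
  "rough_identity U R m G = (THE e. is_rough_identity U R m G e)"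

definition rough_inverse ::
    "'a set \<Rightarrow> ('a \<times> 'a) set \<Rightarrow> ('a \<Rightarrow> 'a \<Rightarrow> 'a) \<Rightarrow> 'a set \<Rightarrow> 'a \<Rightarrow> 'a" where
  "rough_inverse U R m G x =
     (THE y. y \<in> G \<and> m x y = rough_identity U R m G \<and> m y x = rough_identity U R m G)"

definition topological_rough_group ::
    "'a set \<Rightarrow> ('a \<times> 'a) set \<Rightarrow> ('a \<Rightarrow> 'a \<Rightarrow> 'a) \<Rightarrow> 'a set \<Rightarrow> 'a topology \<Rightarrow> bool" where
  "topological_rough_group U R m G \<tau> \<longleftrightarrow>
     rough_group U R m G \<and> topspace \<tau> = upper_approx U R G \<and>
     continuous_map (prod_topology (subtopology \<tau> G) (subtopology \<tau> G)) \<tau> (\<lambda>(x, y). m x y) \<and>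
     continuous_map (subtopology \<tau> G) (subtopology \<tau> G) (rough_inverse U R m G)"

definition rough_subgroup ::
    "'a set \<Rightarrow> ('a \<times> 'a) set \<Rightarrow> ('a \<Rightarrow> 'a \<Rightarrow> 'a) \<Rightarrow> 'a set \<Rightarrow> 'a set \<Rightarrow> bool" where
  "rough_subgroup U R m G H \<longleftrightarrow>
     rough_group U R m G \<and> H \<noteq> {} \<and> H \<subseteq> G \<and> rough_group U R m H"

(* The last conjunct is automatic when G is a topological rough group: see
   topological_rough_subgroup_iff below. *)
definition topological_rough_subgroup ::
    "'a set \<Rightarrow> ('a \<times> 'a) set \<Rightarrow> ('a \<Rightarrow> 'a \<Rightarrow> 'a) \<Rightarrow> 'a set \<Rightarrow> 'a topology \<Rightarrow> 'a set \<Rightarrow> bool" where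
  "topological_rough_subgroup U R m G \<tau> H \<longleftrightarrow>
     rough_subgroup U R m G H \<and>
     topological_rough_group U R m H (subtopology \<tau> (upper_approx U R H))"

lemma upper_approx_mono: "X \<subseteq> Y \<Longrightarrow> upper_approx U R X \<subseteq> upper_approx U R Y"
  by (auto simp: upper_approx_def)

lemma upper_approx_superset:
  assumes "approximation_space U R" "X \<subseteq> U"
  shows "X \<subseteq> upper_approx U R X"
  using assms unfolding approximation_space_def upper_approx_def equiv_def refl_on_def by fast

lemma rough_identity_eqI:
  assumes "is_rough_identity U R m G e"
  shows "rough_identity U R m G = e"
  unfolding rough_identity_def
  by (rule the_equality, rule assms) (use assms in \<open>metis is_rough_identity_def\<close>)

lemma rough_inverse_eqI:
  assumes G: "rough_group U R m G" and x: "x \<in> G" and y: "y \<in> G"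
    and "m x y = rough_identity U R m G" "m y x = rough_identity U R m G"
  shows "rough_inverse U R m G x = y"
  unfolding rough_inverse_def
proof (rule the_equality)
  obtain e where e: "is_rough_identity U R m G e"
    using G unfolding rough_group_def by blast
  have sub: "G \<subseteq> upper_approx U R G"
    using G upper_approx_superset unfolding rough_group_def by blast
  fix z assume z: "z \<in> G \<and> m x z = rough_identity U R m G \<and> m z x = rough_identity U R m G"
  have "m (m z x) y = m z (m x y)"
    using G x y z sub unfolding rough_group_def by blast
  then show "z = y"
    using z y sub e assms(4) rough_identity_eqI[OF e] unfolding is_rough_identity_def
    by (metis subsetD)
qed (use assms in auto)

lemma rough_subgroup_identity:
  assumes "rough_subgroup U R m G H"
  shows "rough_identity U R m H = rough_identity U R m G"
proof -
  have G: "rough_group U R m G" and H: "rough_group U R m H" and "H \<noteq> {}" and HG: "H \<subseteq> G"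
    using assms unfolding rough_subgroup_def by auto
  obtain e where e: "is_rough_identity U R m G e" "\<forall>x\<in>G. \<exists>y\<in>G. m x y = e \<and> m y x = e"
    using G unfolding rough_group_def by blast
  obtain f where f: "is_rough_identity U R m H f"
    using H unfolding rough_group_def by blast
  have sub: "G \<subseteq> upper_approx U R G" "H \<subseteq> upper_approx U R H"
    "upper_approx U R H \<subseteq> upper_approx U R G"
    using upper_approx_superset[of U R G] upper_approx_superset[of U R H] upper_approx_mono[OF HG] G H
    by (simp_all add: rough_group_def)
  obtain x where x: "x \<in> H" using \<open>H \<noteq> {}\<close> by auto
  then obtain y where y: "y \<in> G" "m x y = e" using e(2) HG by blast
  have fG: "f \<in> upper_approx U R G" using f sub unfolding is_rough_identity_def by blast
  have "m (m f x) y = m f (m x y)"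
    using G x y fG sub HG unfolding rough_group_def by blast
  moreover have "m f x = x" using f x sub unfolding is_rough_identity_def by blast
  moreover have "m f e = f" using e fG unfolding is_rough_identity_def by blast
  ultimately have "f = e" using y by simp
  then show ?thesis using rough_identity_eqI e(1) f by metis
qed

lemma rough_subgroup_inverse:
  assumes "rough_subgroup U R m G H" "x \<in> H"
  shows "rough_inverse U R m H x \<in> H" "rough_inverse U R m H x = rough_inverse U R m G x"
proof -
  have G: "rough_group U R m G" and H: "rough_group U R m H" and HG: "H \<subseteq> G"
    using assms unfolding rough_subgroup_def by auto
  obtain y where y: "y \<in> H" "m x y = rough_identity U R m H" "m y x = rough_identity U R m H"
    using H assms(2) rough_identity_eqI unfolding rough_group_def by metis
  have "rough_inverse U R m H x = y"
    using rough_inverse_eqI[OF H assms(2) y] .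
  moreover have "rough_inverse U R m G x = y"
    using rough_inverse_eqI[OF G, of x y] y rough_subgroup_identity[OF assms(1)] assms(2) HG by auto
  ultimately show "rough_inverse U R m H x \<in> H"
    "rough_inverse U R m H x = rough_inverse U R m G x" using y by auto
qed

lemma topological_rough_subgroup_iff:
  assumes "topological_rough_group U R m G \<tau>"
  shows "topological_rough_subgroup U R m G \<tau> H \<longleftrightarrow> rough_subgroup U R m G H"
proof
  assume sg: "rough_subgroup U R m G H"
  let ?uH = "upper_approx U R H"
  have H: "rough_group U R m H" and HG: "H \<subseteq> G"
    using sg unfolding rough_subgroup_def by auto
  have HuH: "H \<subseteq> ?uH" using H upper_approx_superset unfolding rough_group_def by blast
  have top: "topspace \<tau> = upper_approx U R G" using assms unfolding topological_rough_group_def by auto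
  have uHG: "?uH \<subseteq> upper_approx U R G" using HG by (rule upper_approx_mono)
  have st: "subtopology (subtopology \<tau> ?uH) H = subtopology (subtopology \<tau> G) H"
    using HuH HG by (simp add: subtopology_subtopology inf_absorb2)
  have st2: "prod_topology (subtopology (subtopology \<tau> ?uH) H) (subtopology (subtopology \<tau> ?uH) H) =
      subtopology (prod_topology (subtopology \<tau> G) (subtopology \<tau> G)) (H \<times> H)"
    unfolding st using HG
    by (simp add: subtopology_Times subtopology_subtopology inf_absorb2)
  have "continuous_map (prod_topology (subtopology (subtopology \<tau> ?uH) H) (subtopology (subtopology \<tau> ?uH) H))
          (subtopology \<tau> ?uH) (\<lambda>(x, y). m x y)"
    unfolding continuous_map_in_subtopology
  proof
    show "continuous_map (prod_topology (subtopology (subtopology \<tau> ?uH) H)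
        (subtopology (subtopology \<tau> ?uH) H)) \<tau> (\<lambda>(x, y). m x y)"
      unfolding st2 using assms unfolding topological_rough_group_def
      by (blast intro: continuous_map_from_subtopology)
    show "(\<lambda>(x, y). m x y) \<in> topspace (prod_topology (subtopology (subtopology \<tau> ?uH) H)
        (subtopology (subtopology \<tau> ?uH) H)) \<rightarrow> ?uH"
      using H unfolding rough_group_def by auto
  qed
  moreover have "continuous_map (subtopology (subtopology \<tau> ?uH) H) (subtopology (subtopology \<tau> ?uH) H)
      (rough_inverse U R m H)"
  proof (rule continuous_map_eq)
    show "continuous_map (subtopology (subtopology \<tau> ?uH) H) (subtopology (subtopology \<tau> ?uH) H)
      (rough_inverse U R m G)"
      unfolding st continuous_map_in_subtopology
      using assms rough_subgroup_inverse[OF sg] unfolding topological_rough_group_def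
      by (auto intro!: continuous_map_from_subtopology simp: continuous_map_in_subtopology)
  qed (use rough_subgroup_inverse[OF sg] in auto)
  ultimately show "topological_rough_subgroup U R m G \<tau> H"
    using sg H top uHG unfolding topological_rough_subgroup_def topological_rough_group_def
    by (auto simp: inf_absorb2)
qed (simp add: topological_rough_subgroup_def)

definition topological_group :: "('a, 'b) monoid_scheme \<Rightarrow> 'a topology \<Rightarrow> bool" where
  "topological_group U T \<longleftrightarrow>
     group U \<and> topspace T = carrier U \<and>
     continuous_map (prod_topology T T) T (\<lambda>(x, y). x \<otimes>\<^bsub>U\<^esub> y) \<and>
     continuous_map T T (\<lambda>x. inv\<^bsub>U\<^esub> x)"

(* The classes of rcong\<^bsub>U\<^esub> N are the left cosets u <#\<^bsub>U\<^esub> N: see subgroup.l_coset_eq_rcong. *)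
abbreviation upper_approx_wrt :: "('a, 'b) monoid_scheme \<Rightarrow> 'a set \<Rightarrow> 'a set \<Rightarrow> 'a set" where
  "upper_approx_wrt U N X \<equiv> upper_approx (carrier U) (rcong\<^bsub>U\<^esub> N) X"

definition topological_rough_group_wrt ::
    "('a, 'b) monoid_scheme \<Rightarrow> 'a topology \<Rightarrow> 'a set \<Rightarrow> 'a set \<Rightarrow> bool" where
  "topological_rough_group_wrt U T N G \<longleftrightarrow>
     topological_group U T \<and> N \<lhd> U \<and> G \<noteq> {} \<and>
     topological_rough_group (carrier U) (rcong\<^bsub>U\<^esub> N) (mult U) G
       (subtopology T (upper_approx_wrt U N G))"

definition topological_rough_subgroup_wrt ::
    "('a, 'b) monoid_scheme \<Rightarrow> 'a topology \<Rightarrow> 'a set \<Rightarrow> 'a set \<Rightarrow> 'a set \<Rightarrow> bool" where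
  "topological_rough_subgroup_wrt U T N G H \<longleftrightarrow>
     topological_rough_group_wrt U T N G \<and>
     topological_rough_subgroup (carrier U) (rcong\<^bsub>U\<^esub> N) (mult U) G
       (subtopology T (upper_approx_wrt U N G)) H"

end

(* The upper approximation of X is X N. A point outside H N has its open coset disjoint from H, so
   both closures of H lie between H and H N; hence their upper approximations equal H N N = H N, and
   products of their elements stay in H N because H H is contained in H N and N is normal.
   Inverses stay in the closures since inversion is continuous. *)
theory Submission
  imports Defs
begin

text \<open>The class of \<open>x\<close> is the coset \<open>x N\<close>, and \<open>y\<close> lies
  in it exactly when \<open>inv x * y\<close> is in \<open>N\<close>. Since \<open>N\<close> is
  closed under inverses, this is the same as \<open>x\<close> lying in \<open>y N\<close>. All later
  computations with upper approximations become computations with products of sets.\<close>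

lemma upper_approx_wrt_eq_set_mult:
  assumes "N \<lhd> U" "X \<subseteq> carrier U"
  shows "upper_approx_wrt U N X = X <#>\<^bsub>U\<^esub> N"
proof -
  interpret normal N U by fact
  show ?thesis
  proof (intro Set.set_eqI iffI)
    fix x assume "x \<in> upper_approx_wrt U N X"
    then obtain y where y: "x \<in> carrier U" "y \<in> X" "y \<in> carrier U" "inv\<^bsub>U\<^esub> x \<otimes>\<^bsub>U\<^esub> y \<in> N"
      by (auto simp: upper_approx_def r_congruent_def)
    have "x = y \<otimes>\<^bsub>U\<^esub> inv\<^bsub>U\<^esub> (inv\<^bsub>U\<^esub> x \<otimes>\<^bsub>U\<^esub> y)"
      using y by (simp add: inv_mult_group m_assoc[symmetric])
    then show "x \<in> X <#>\<^bsub>U\<^esub> N" using y unfolding set_mult_def by blast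
  next
    fix x assume "x \<in> X <#>\<^bsub>U\<^esub> N"
    then obtain y n where y: "y \<in> X" "n \<in> N" "x = y \<otimes>\<^bsub>U\<^esub> n"
      unfolding set_mult_def by blast
    have c: "y \<in> carrier U" "n \<in> carrier U" using y assms(2) by auto
    then have "inv\<^bsub>U\<^esub> x \<otimes>\<^bsub>U\<^esub> y = inv\<^bsub>U\<^esub> n"
      using y by (simp add: inv_mult_group m_assoc)
    then show "x \<in> upper_approx_wrt U N X"
      using y c by (auto simp: upper_approx_def r_congruent_def)
  qed
qed

text \<open>Normality moves the middle factor to the right: \<open>(x m) (y n) = (x y) (k n)\<close>
  with \<open>k\<close> a conjugate of \<open>m\<close>. By hypothesis \<open>x y\<close> is in
  \<open>X N\<close>, and the remaining factor from \<open>N\<close> is absorbed.\<close>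

lemma set_mult_normal_closed:
  assumes "N \<lhd> U" "X \<subseteq> carrier U"
    and XX: "\<And>x y. x \<in> X \<Longrightarrow> y \<in> X \<Longrightarrow> x \<otimes>\<^bsub>U\<^esub> y \<in> X <#>\<^bsub>U\<^esub> N"
    and "a \<in> X <#>\<^bsub>U\<^esub> N" "b \<in> X <#>\<^bsub>U\<^esub> N"
  shows "a \<otimes>\<^bsub>U\<^esub> b \<in> X <#>\<^bsub>U\<^esub> N"
proof -
  interpret normal N U by fact
  obtain x m y n where xy: "x \<in> X" "m \<in> N" "a = x \<otimes>\<^bsub>U\<^esub> m" "y \<in> X" "n \<in> N" "b = y \<otimes>\<^bsub>U\<^esub> n"
    using assms(4,5) unfolding set_mult_def by blast
  have c: "x \<in> carrier U" "m \<in> carrier U" "y \<in> carrier U" "n \<in> carrier U"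
    using xy assms(2) by auto
  \<comment> \<open>This conjugate is the element of \<open>N\<close> with
    \<open>m y = y k\<close>.\<close>
  define k where "k = inv\<^bsub>U\<^esub> y \<otimes>\<^bsub>U\<^esub> m \<otimes>\<^bsub>U\<^esub> y"
  have k: "k \<in> N" using inv_op_closed1 xy c by (simp add: k_def)
  have "m \<otimes>\<^bsub>U\<^esub> y = y \<otimes>\<^bsub>U\<^esub> k" using c by (simp add: k_def m_assoc[symmetric])
  then have ab: "a \<otimes>\<^bsub>U\<^esub> b = x \<otimes>\<^bsub>U\<^esub> y \<otimes>\<^bsub>U\<^esub> (k \<otimes>\<^bsub>U\<^esub> n)"
    using xy c k by (metis m_assoc m_closed mem_carrier)
  obtain z l where z: "z \<in> X" "l \<in> N" "x \<otimes>\<^bsub>U\<^esub> y = z \<otimes>\<^bsub>U\<^esub> l"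
    using XX[OF xy(1,4)] unfolding set_mult_def by blast
  have "a \<otimes>\<^bsub>U\<^esub> b = z \<otimes>\<^bsub>U\<^esub> (l \<otimes>\<^bsub>U\<^esub> (k \<otimes>\<^bsub>U\<^esub> n))"
    using ab z k c assms(2) by (simp add: m_assoc subset_iff)
  moreover have "l \<otimes>\<^bsub>U\<^esub> (k \<otimes>\<^bsub>U\<^esub> n) \<in> N" using z k xy by simp
  ultimately show ?thesis using z unfolding set_mult_def by blast
qed

text \<open>A rough identity belongs to the upper approximation on which it acts neutrally, so it is
  an idempotent of the group \<open>U\<close>.\<close>

lemma is_rough_identity_one:
  assumes "N \<lhd> U" "X \<subseteq> carrier U"
    and e: "is_rough_identity (carrier U) (rcong\<^bsub>U\<^esub> N) (mult U) X e"
  shows "e = \<one>\<^bsub>U\<^esub>"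
proof -
  interpret normal N U by fact
  have "e \<in> carrier U" "e \<otimes>\<^bsub>U\<^esub> e = e"
    using e by (auto simp: is_rough_identity_def upper_approx_def)
  then show ?thesis by (metis l_cancel_one)
qed

text \<open>Associativity and both continuity conditions are inherited from \<open>U\<close>, once
  the rough identity and the rough inverse are recognised as those of the group. What remains is
  purely algebraic, and it is this form that is checked for the closures of
  \<open>H\<close>.\<close>

lemma topological_rough_group_wrt_iff:
  assumes U: "topological_group U T" and N: "N \<lhd> U"
  shows "topological_rough_group_wrt U T N X \<longleftrightarrow>
    X \<noteq> {} \<and> X \<subseteq> carrier U \<and> (\<forall>x\<in>X. \<forall>y\<in>X. x \<otimes>\<^bsub>U\<^esub> y \<in> X <#>\<^bsub>U\<^esub> N) \<and> (\<forall>x\<in>X. inv\<^bsub>U\<^esub> x \<in> X)"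
    (is "?L \<longleftrightarrow> ?R")
proof
  interpret normal N U by fact
  assume ?L
  then have ne: "X \<noteq> {}" and rg: "rough_group (carrier U) (rcong\<^bsub>U\<^esub> N) (mult U) X"
    by (auto simp: topological_rough_group_wrt_def topological_rough_group_def)
  have sub: "X \<subseteq> carrier U" using rg by (simp add: rough_group_def)
  obtain e where e: "is_rough_identity (carrier U) (rcong\<^bsub>U\<^esub> N) (mult U) X e"
      "\<forall>x\<in>X. \<exists>y\<in>X. x \<otimes>\<^bsub>U\<^esub> y = e \<and> y \<otimes>\<^bsub>U\<^esub> x = e"
    using rg unfolding rough_group_def by blast
  have "inv\<^bsub>U\<^esub> x \<in> X" if x: "x \<in> X" for x
  proof -
    \<comment> \<open>A rough inverse of \<open>x\<close> in \<open>X\<close> is a group inverse,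
      because the rough identity is the unit.\<close>
    obtain y where "y \<in> X" "y \<otimes>\<^bsub>U\<^esub> x = \<one>\<^bsub>U\<^esub>"
      using e is_rough_identity_one[OF N sub] x by blast
    then show ?thesis using x sub by (metis inv_equality subsetD)
  qed
  then show ?R using ne sub rg
    unfolding rough_group_def upper_approx_wrt_eq_set_mult[OF N sub] by simp
next
  interpret normal N U by fact
  assume R: ?R
  then have sub: "X \<subseteq> carrier U" by blast
  let ?XN = "X <#>\<^bsub>U\<^esub> N"
  note up = upper_approx_wrt_eq_set_mult[OF N sub]
  have XNc: "?XN \<subseteq> carrier U" using sub by (simp add: set_mult_closed subset)
  have ap: "approximation_space (carrier U) (rcong\<^bsub>U\<^esub> N)"
    unfolding approximation_space_def using equiv_rcong by auto
  have XXN: "X \<subseteq> ?XN" using upper_approx_superset[OF ap sub] up by simp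
  \<comment> \<open>The unit may lie outside \<open>X\<close>; it is only found in
    \<open>X N\<close>, as the product of some \<open>x\<close> in \<open>X\<close> with its
    inverse.\<close>
  have one: "\<one>\<^bsub>U\<^esub> \<in> ?XN"
  proof -
    obtain x where x: "x \<in> X" using R by blast
    then have "x \<otimes>\<^bsub>U\<^esub> inv\<^bsub>U\<^esub> x \<in> ?XN" using R by blast
    then show ?thesis using x sub by (simp add: subset_iff)
  qed
  have ident: "is_rough_identity (carrier U) (rcong\<^bsub>U\<^esub> N) (mult U) X \<one>\<^bsub>U\<^esub>"
    unfolding is_rough_identity_def up using one XNc by auto
  have rg: "rough_group (carrier U) (rcong\<^bsub>U\<^esub> N) (mult U) X"
    unfolding rough_group_def
  proof (intro conjI)
    show "\<exists>e. is_rough_identity (carrier U) (rcong\<^bsub>U\<^esub> N) (mult U) X e \<and>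
        (\<forall>x\<in>X. \<exists>y\<in>X. x \<otimes>\<^bsub>U\<^esub> y = e \<and> y \<otimes>\<^bsub>U\<^esub> x = e)"
      using ident R by (intro exI[of _ "\<one>\<^bsub>U\<^esub>"]) (auto intro!: bexI[of _ "inv\<^bsub>U\<^esub> _"])
    show "\<forall>x\<in>upper_approx_wrt U N X. \<forall>y\<in>upper_approx_wrt U N X. \<forall>z\<in>upper_approx_wrt U N X.
        x \<otimes>\<^bsub>U\<^esub> y \<otimes>\<^bsub>U\<^esub> z = x \<otimes>\<^bsub>U\<^esub> (y \<otimes>\<^bsub>U\<^esub> z)"
      unfolding up using XNc m_assoc by blast
  qed (use ap R up in auto)
  \<comment> \<open>\<open>rough_inverse\<close> is a definite description; its uniqueness
    identifies it on \<open>X\<close> with group inversion, whose continuity is known.\<close>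
  have inv: "rough_inverse (carrier U) (rcong\<^bsub>U\<^esub> N) (mult U) X x = inv\<^bsub>U\<^esub> x" if "x \<in> X" for x
    by (rule rough_inverse_eqI[OF rg that])
      (use R that sub in \<open>auto simp: rough_identity_eqI[OF ident] subset_iff\<close>)
  have T: "topspace T = carrier U" "continuous_map (prod_topology T T) T (\<lambda>(x, y). x \<otimes>\<^bsub>U\<^esub> y)"
    "continuous_map T T (\<lambda>x. inv\<^bsub>U\<^esub> x)"
    using U by (simp_all add: topological_group_def)
  have st: "subtopology (subtopology T ?XN) X = subtopology T X"
    using XXN by (simp add: subtopology_subtopology inf_absorb2)
  have "continuous_map (prod_topology (subtopology T X) (subtopology T X)) (subtopology T ?XN)
      (\<lambda>(x, y). x \<otimes>\<^bsub>U\<^esub> y)"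
    unfolding continuous_map_in_subtopology subtopology_Times[symmetric]
    using R continuous_map_from_subtopology[OF T(2)] by auto
  moreover have "continuous_map (subtopology T X) (subtopology T X)
      (rough_inverse (carrier U) (rcong\<^bsub>U\<^esub> N) (mult U) X)"
  proof (rule continuous_map_eq)
    show "continuous_map (subtopology T X) (subtopology T X) (\<lambda>x. inv\<^bsub>U\<^esub> x)"
      unfolding continuous_map_in_subtopology
      using R continuous_map_from_subtopology[OF T(3)] by auto
  qed (use inv in auto)
  ultimately show ?L
    using U N R rg XNc T(1)
    unfolding topological_rough_group_wrt_def topological_rough_group_def up
    by (auto simp: st)
qed

text \<open>The upper approximation of \<open>H\<close> lies inside that of \<open>G\<close>, so the
  topology it gets through \<open>G\<close> is the one induced directly from \<open>T\<close>. Hence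
  the algebraic criterion applies to subgroups as well.\<close>

lemma topological_rough_subgroup_wrt_iff:
  "topological_rough_subgroup_wrt U T N G H \<longleftrightarrow>
    topological_rough_group_wrt U T N G \<and> topological_rough_group_wrt U T N H \<and> H \<subseteq> G"
proof -
  have st: "subtopology (subtopology T (upper_approx_wrt U N G)) (upper_approx_wrt U N H) =
      subtopology T (upper_approx_wrt U N H)" if "H \<subseteq> G"
    using upper_approx_mono[OF that] by (simp add: subtopology_subtopology inf_absorb2)
  show ?thesis
  proof
    assume "topological_rough_subgroup_wrt U T N G H"
    then show "topological_rough_group_wrt U T N G \<and> topological_rough_group_wrt U T N H \<and> H \<subseteq> G"
      using st unfolding topological_rough_subgroup_wrt_def topological_rough_subgroup_def
        rough_subgroup_def topological_rough_group_wrt_def by simp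
  next
    assume "topological_rough_group_wrt U T N G \<and> topological_rough_group_wrt U T N H \<and> H \<subseteq> G"
    then show "topological_rough_subgroup_wrt U T N G H"
      using st unfolding topological_rough_subgroup_wrt_def topological_rough_subgroup_def
        rough_subgroup_def topological_rough_group_wrt_def topological_rough_group_def by simp
  qed
qed

text \<open>For \<open>x\<close> in the closure, \<open>x N\<close> is an open neighbourhood of
  \<open>x\<close> and therefore meets \<open>H\<close>, which puts \<open>x\<close> in the upper
  approximation of \<open>H\<close>.\<close>

lemma closure_of_subset_open_normal_mult:
  assumes U: "topological_group U T" and N: "N \<lhd> U" and "openin T N" and "H \<subseteq> carrier U"
  shows "T closure_of H \<subseteq> H <#>\<^bsub>U\<^esub> N"
proof
  interpret normal N U by fact
  fix x assume x: "x \<in> T closure_of H"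
  have T: "topspace T = carrier U" "continuous_map (prod_topology T T) T (\<lambda>(x, y). x \<otimes>\<^bsub>U\<^esub> y)"
    using U by (simp_all add: topological_group_def)
  have xc: "x \<in> carrier U" using x T(1) by (auto simp: in_closure_of)
  have "continuous_map T (prod_topology T T) (\<lambda>y. (inv\<^bsub>U\<^esub> x, y))"
    using xc T(1) by (simp add: continuous_map_pairwise o_def)
  then have "continuous_map T T (\<lambda>y. inv\<^bsub>U\<^esub> x \<otimes>\<^bsub>U\<^esub> y)"
    using continuous_map_compose[OF _ T(2)] by (fastforce simp: o_def)
  \<comment> \<open>This set is the coset \<open>x N\<close>, written as the preimage of
    \<open>N\<close> under left translation by \<open>inv x\<close>.\<close>
  then have "openin T {y \<in> topspace T. inv\<^bsub>U\<^esub> x \<otimes>\<^bsub>U\<^esub> y \<in> N}"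
    using \<open>openin T N\<close> by (rule openin_continuous_map_preimage)
  moreover have "x \<in> {y \<in> topspace T. inv\<^bsub>U\<^esub> x \<otimes>\<^bsub>U\<^esub> y \<in> N}" using xc T(1) by simp
  ultimately have "\<exists>y. y \<in> H \<and> y \<in> {y \<in> topspace T. inv\<^bsub>U\<^esub> x \<otimes>\<^bsub>U\<^esub> y \<in> N}"
    using x unfolding in_closure_of by meson
  then obtain y where "y \<in> H" "inv\<^bsub>U\<^esub> x \<otimes>\<^bsub>U\<^esub> y \<in> N" "y \<in> carrier U"
    using T(1) by auto
  then have "x \<in> upper_approx_wrt U N H"
    using xc by (auto simp: upper_approx_def r_congruent_def)
  then show "x \<in> H <#>\<^bsub>U\<^esub> N" using upper_approx_wrt_eq_set_mult[OF N assms(4)] by simp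
qed

text \<open>Multiplying the inclusions for \<open>X\<close> by \<open>N\<close> squeezes
  \<open>X N\<close> between \<open>H N\<close> and \<open>H N N\<close>, which equals
  \<open>H N\<close>. Stating this for an arbitrary intermediate \<open>X\<close> allows one
  argument to serve both closures.\<close>

lemma topological_rough_group_wrt_between:
  assumes U: "topological_group U T" and N: "N \<lhd> U" and H: "topological_rough_group_wrt U T N H"
    and HX: "H \<subseteq> X" and XHN: "X \<subseteq> H <#>\<^bsub>U\<^esub> N" and inv: "\<And>x. x \<in> X \<Longrightarrow> inv\<^bsub>U\<^esub> x \<in> X"
  shows "topological_rough_group_wrt U T N X" "upper_approx_wrt U N X = H <#>\<^bsub>U\<^esub> N"
proof -
  interpret normal N U by fact
  note HR = H[unfolded topological_rough_group_wrt_iff[OF U N]]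
  have Hc: "H \<subseteq> carrier U" using HR by blast
  have Xc: "X \<subseteq> carrier U" using XHN set_mult_closed[OF Hc subset] by blast
  have "X <#>\<^bsub>U\<^esub> N \<subseteq> H <#>\<^bsub>U\<^esub> N <#>\<^bsub>U\<^esub> N"
    using XHN unfolding set_mult_def by blast
  also have "\<dots> = H <#>\<^bsub>U\<^esub> N"
    using set_mult_assoc[OF Hc subset subset] subgroup_mult_id[OF subgroup_axioms] by simp
  finally have XN: "X <#>\<^bsub>U\<^esub> N = H <#>\<^bsub>U\<^esub> N"
    using HX unfolding set_mult_def by blast
  then show "upper_approx_wrt U N X = H <#>\<^bsub>U\<^esub> N"
    using upper_approx_wrt_eq_set_mult[OF N Xc] by simp
  \<comment> \<open>The closure property of \<open>H N\<close> is obtained from products in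
    \<open>H\<close> alone; it covers \<open>X\<close> because \<open>X\<close> sits inside
    \<open>H N\<close>.\<close>
  have "x \<otimes>\<^bsub>U\<^esub> y \<in> X <#>\<^bsub>U\<^esub> N" if "x \<in> X" "y \<in> X" for x y
    unfolding XN using set_mult_normal_closed[OF N Hc] HR XHN that by blast
  then show "topological_rough_group_wrt U T N X"
    unfolding topological_rough_group_wrt_iff[OF U N] using HR HX Xc inv by blast
qed

theorem proposition5p8:
  fixes U :: "('a, 'b) monoid_scheme" and T \<tau> :: "'a topology" and N G H H\<tau> Hc :: "'a set"
  assumes "topological_group U T"
    and "N \<lhd> U" and "openin T N"
    and "topological_rough_group_wrt U T N G"
    and "\<tau> = subtopology T (upper_approx_wrt U N G)"
    and "topological_rough_subgroup_wrt U T N G H"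
    and "H\<tau> = \<tau> closure_of H"
    and "Hc = (subtopology \<tau> G) closure_of H"
  shows "(upper_approx_wrt U N H\<tau> = upper_approx_wrt U N (H\<tau> \<inter> G) \<and>
          upper_approx_wrt U N (H\<tau> \<inter> G) = upper_approx_wrt U N H \<and>
          upper_approx_wrt U N H = H <#>\<^bsub>U\<^esub> N) \<and>
         (topological_rough_group_wrt U T N H\<tau> \<and>
          upper_approx_wrt U N H\<tau> = upper_approx_wrt U N H \<and>
          upper_approx_wrt U N H = H <#>\<^bsub>U\<^esub> N) \<and>
         (topological_rough_subgroup_wrt U T N G Hc \<and>
          upper_approx_wrt U N Hc = upper_approx_wrt U N H \<and>
          upper_approx_wrt U N H = H <#>\<^bsub>U\<^esub> N)"
proof -
  interpret normal N U by fact
  note U = assms(1) and N = assms(2)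
  have G: "topological_rough_group_wrt U T N G" and H: "topological_rough_group_wrt U T N H"
    and HG: "H \<subseteq> G"
    using assms(6) unfolding topological_rough_subgroup_wrt_iff by auto
  note GR = G[unfolded topological_rough_group_wrt_iff[OF U N]]
  note HR = H[unfolded topological_rough_group_wrt_iff[OF U N]]
  have Gc: "G \<subseteq> carrier U" and Hc: "H \<subseteq> carrier U" using GR HR by auto
  have upH: "upper_approx_wrt U N H = H <#>\<^bsub>U\<^esub> N"
    and upG: "upper_approx_wrt U N G = G <#>\<^bsub>U\<^esub> N"
    using upper_approx_wrt_eq_set_mult[OF N] Gc Hc by auto
  have GGN: "G \<subseteq> G <#>\<^bsub>U\<^esub> N"
    using upper_approx_superset[of "carrier U" "rcong\<^bsub>U\<^esub> N" G] Gc equiv_rcong upG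
    by (auto simp: approximation_space_def)
  have clHN: "T closure_of H \<subseteq> H <#>\<^bsub>U\<^esub> N"
    by (rule closure_of_subset_open_normal_mult[OF U N assms(3) Hc])
  have HNGN: "H <#>\<^bsub>U\<^esub> N \<subseteq> G <#>\<^bsub>U\<^esub> N" using HG unfolding set_mult_def by blast
  \<comment> \<open>A closure in a subspace is the trace of the closure in \<open>U\<close>. Here
    the trace is the whole closure, as it lies in \<open>H N\<close> and so in
    \<open>G N\<close>.\<close>
  have H\<tau>: "H\<tau> = T closure_of H"
    using assms(5,7) upG clHN HNGN HG GGN
    by (simp add: closure_of_subtopology inf_absorb2)
  \<comment> \<open>Taking the trace on \<open>G\<close> shows that the intersection in the first
    claim and the closure in the third are the same set.\<close>
  have Hc_eq: "Hc = H\<tau> \<inter> G"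
    using assms(5,7,8) HG by (simp add: closure_of_subtopology inf_absorb2 Int_commute)
  have HH\<tau>: "H \<subseteq> H\<tau>"
    using closure_of_subset[of H T] Hc U unfolding H\<tau> topological_group_def by simp
  \<comment> \<open>Continuity of inversion sends the closure of \<open>H\<close> into the closure
    of the image of \<open>H\<close>, and that image lies in \<open>H\<close>.\<close>
  have inv\<tau>: "inv\<^bsub>U\<^esub> x \<in> H\<tau>" if "x \<in> H\<tau>" for x
  proof -
    have "(\<lambda>x. inv\<^bsub>U\<^esub> x) ` (T closure_of H) \<subseteq> T closure_of ((\<lambda>x. inv\<^bsub>U\<^esub> x) ` H)"
      using U unfolding topological_group_def by (metis continuous_map_image_closure_subset)
    also have "\<dots> \<subseteq> T closure_of H"
      using HR by (intro closure_of_mono) blast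
    finally show ?thesis using that unfolding H\<tau> by blast
  qed
  note \<tau> = topological_rough_group_wrt_between[OF U N H HH\<tau> clHN[folded H\<tau>] inv\<tau>]
  \<comment> \<open>Inverses stay in the intersection because \<open>G\<close>, too, is closed under
    them.\<close>
  have "H \<subseteq> H\<tau> \<inter> G" "H\<tau> \<inter> G \<subseteq> H <#>\<^bsub>U\<^esub> N" "\<And>x. x \<in> H\<tau> \<inter> G \<Longrightarrow> inv\<^bsub>U\<^esub> x \<in> H\<tau> \<inter> G"
    using HG HH\<tau> clHN H\<tau> inv\<tau> GR by auto
  note c = topological_rough_group_wrt_between[OF U N H this]
  show ?thesis
    using \<tau> c upH G unfolding topological_rough_subgroup_wrt_iff Hc_eq by auto
qed

end
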